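(* For $\mathbf{t}, \mathbf{k}\in \mathbb{N}_0^{(\infty)}$, we have $$ \langle \mathsf{S}^{(\mathbf{t})},\mathsf{M}^{(\mathbf{k})}\rangle=\delta_{\mathbf{t}}^{\mathbf{k}}, $$ where $\delta_{\mathbf{t}}^{\mathbf{k}}$ is the Kronecker symbol, equal to $0$ if $\mathbf{t}\ne\mathbf{k}$ and $1$ if $\mathbf{t}=\mathbf{k}$.
   Context: Let $R$ be a commutative integral domain of characteristic 0 and $R\langle X,Y\rangle$ the free associative algebra over $R$ on two non-commuting letters $X,Y$, with $[u,v]=uv-vu$. Set $Y^{(0)}=Y$, $Y^{(k+1)}=[X,Y^{(k)}]$ for $k\ge 0$. Let $\mathbb{N}_0$ be the non-negative integers and $\mathbb{N}_0^{(\infty)}$ the set of finite sequences $\mathbf{k}=(k_1,\dots,k_d;k_\infty)$ of non-negative integers with $d\ge 0$ and a special last entry $k_\infty\in\mathbb{N}_0$. For such $\mathbf{k}$, the Magnus polynomial is $\mathsf{M}^{(\mathbf{k})}=Y^{(k_1)}\cdots Y^{(k_d)}X^{k_\infty}$ (with $\mathsf{M}^{(;k)}=X^k$), and the demi-shuffle polynomial is $\mathsf{S}^{(\mathbf{k})}=(\cdots((X^{k_1}Y)\,\text{ш}\, X^{k_2})Y)\,\text{ш}\cdots\text{ш}\, X^{k_d})Y)\,\text{ш}\, X^{k_\infty}$, where ш denotes the usual shuffle product (with $\mathsf{S}^{(;k)}=X^k$). The pairing $\langle\ ,\ \rangle$ is the standard $R$-bilinear pairing on $R\langle X,Y\rangle$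 for which the words (monomials in $X,Y$, including $1$) form an orthonormal basis, i.e. $\langle w,w'\rangle=\delta_w^{w'}$ for words $w,w'$. *)

theory Defs
  imports "HOL-Library.Poly_Mapping"
begin

text \<open>
  Words form the free monoid under concatenation. \<open>Poly_Mapping\<close> provides the monoid algebra
  of an additively written monoid, so concatenation is registered as addition on lists.
  The monoid algebra of the words in two letters is the free associative algebra.
\<close>

instantiation list :: (type) monoid_add
begin

definition zero_list :: "'a list" where
  "zero_list = []"

definition plus_list :: "'a list \<Rightarrow> 'a list \<Rightarrow> 'a list" where
  "plus_list u v = u @ v"

instance
  by standard (simp_all add: zero_list_def plus_list_def)

end

datatype letter = LX | LY

type_synonym 'r free_alg = "letter list \<Rightarrow>\<^sub>0 'r"

definition monomial :: "letter list \<Rightarrow> 'r::comm_ring_1 free_alg" where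
  "monomial w = Poly_Mapping.single w 1"

definition scale :: "'r::comm_ring_1 \<Rightarrow> 'r free_alg \<Rightarrow> 'r free_alg" where
  "scale c p = Poly_Mapping.single [] c * p"

definition gen_X :: "'r::comm_ring_1 free_alg" where
  "gen_X = monomial [LX]"

definition gen_Y :: "'r::comm_ring_1 free_alg" where
  "gen_Y = monomial [LY]"

definition commutator :: "'r::comm_ring_1 free_alg \<Rightarrow> 'r free_alg \<Rightarrow> 'r free_alg" where
  "commutator u v = u * v - v * u"

primrec Y_ad :: "nat \<Rightarrow> 'r::comm_ring_1 free_alg" where
  "Y_ad 0 = gen_Y"
| "Y_ad (Suc k) = commutator gen_X (Y_ad k)"

text \<open>The shuffle product counts multiplicities, unlike the set-valued \<open>shuffles\<close> on lists.\<close>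

fun shuffle_words :: "letter list \<Rightarrow> letter list \<Rightarrow> 'r::comm_ring_1 free_alg" where
  "shuffle_words [] v = monomial v"
| "shuffle_words u [] = monomial u"
| "shuffle_words (a # u) (b # v) =
     monomial [a] * shuffle_words u (b # v) + monomial [b] * shuffle_words (a # u) v"

definition shuffle :: "'r::comm_ring_1 free_alg \<Rightarrow> 'r free_alg \<Rightarrow> 'r free_alg" where
  "shuffle p q = (\<Sum>u\<in>Poly_Mapping.keys p. \<Sum>v\<in>Poly_Mapping.keys q.
     scale (Poly_Mapping.lookup p u * Poly_Mapping.lookup q v) (shuffle_words u v))"

definition pairing :: "'r::comm_ring_1 free_alg \<Rightarrow> 'r free_alg \<Rightarrow> 'r" where
  "pairing p q = (\<Sum>w\<in>Poly_Mapping.keys p. Poly_Mapping.lookup p w * Poly_Mapping.lookup q w)"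

text \<open>The pair \<open>([k\<^sub>1, \<dots>, k\<^sub>d], m)\<close> stands for the sequence \<open>(k\<^sub>1, \<dots>, k\<^sub>d; m)\<close> with special last entry \<open>m\<close>.\<close>

type_synonym index = "nat list \<times> nat"

fun magnus :: "index \<Rightarrow> 'r::comm_ring_1 free_alg" where
  "magnus (ks, m) = prod_list (map Y_ad ks) * gen_X ^ m"

fun demi_shuffle :: "index \<Rightarrow> 'r::comm_ring_1 free_alg" where
  "demi_shuffle ([], m) = gen_X ^ m"
| "demi_shuffle (k # ks, m) =
     shuffle (foldl (\<lambda>p j. shuffle p (gen_X ^ j) * gen_Y) (gen_X ^ k * gen_Y) ks) (gen_X ^ m)"

end

theory Submission
  imports Defs
begin

text \<open>
  Let \<open>D n\<close> be the adjoint of shuffling with \<open>X^n\<close>. The generating series \<open>\<Sum>n. D n z^n\<close> is the algebra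
  homomorphism \<open>X \<mapsto> X + z\<close>, \<open>Y \<mapsto> Y\<close>, because shuffling is dual to the coproduct for which the letters
  are primitive. It fixes each \<open>Y_ad k\<close>, since adding the central \<open>z\<close> to \<open>X\<close> does not change \<open>[X, _]\<close>.
  Hence \<open>D n\<close> maps \<open>magnus (ks, m)\<close> to \<open>(m choose n)\<close> times \<open>magnus (ks, m - n)\<close>. What is paired with
  this ends in \<open>Y\<close>, which forces \<open>m = n\<close>, and cancelling the last \<open>Y\<close> turns the last factor \<open>Y_ad k\<close>
  into \<open>X^k\<close>. This is the original pairing with one entry fewer on both sides.
\<close>

text \<open>Reduces additive identities in the free algebra to multiples of single words.\<close>

lemma poly_mapping_single_induct [case_names single add]:
  fixes p :: "'a \<Rightarrow>\<^sub>0 'b::comm_monoid_add"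
  assumes single: "\<And>k v. P (Poly_Mapping.single k v)"
    and add: "\<And>p q. P p \<Longrightarrow> P q \<Longrightarrow> P (p + q)"
  shows "P p"
proof (induction p rule: update_induct)
  case const
  show ?case
    using single[of undefined 0] by simp
next
  case (update p k v)
  \<comment> \<open>The key \<open>k\<close> is new to \<open>p\<close>, so updating amounts to
    adding.\<close>
  have "Poly_Mapping.update k v p = p + Poly_Mapping.single k v"
    using update.hyps
    by (intro poly_mapping_eqI)
      (auto simp: lookup_update lookup_add lookup_single in_keys_iff when_def)
  with update.IH show ?case
    using add single by metis
qed

section \<open>Arithmetic of the free algebra\<close>

lemma single_mult_single_list:
  fixes a b :: "'r::comm_ring_1"
  shows "Poly_Mapping.single u a * Poly_Mapping.single v b = Poly_Mapping.single (u @ v) (a * b)"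
  by (simp add: mult_single plus_list_def)

lemma one_free_alg: "(1 :: 'r::comm_ring_1 free_alg) = Poly_Mapping.single [] 1"
  by (simp add: zero_list_def flip: single_one)

lemma scale_single [simp]:
  "scale c (Poly_Mapping.single w d) = Poly_Mapping.single w (c * d)"
  by (simp add: scale_def single_mult_single_list)

lemma scale_0_left [simp]: "scale 0 p = 0"
  by (simp add: scale_def)

lemma scale_0_right [simp]: "scale c 0 = 0"
  by (simp add: scale_def)

lemma scale_add_left: "scale (c + d) p = scale c p + scale d p"
  by (simp add: scale_def single_add distrib_right)

lemma scale_add_right: "scale c (p + q) = scale c p + scale c q"
  by (simp add: scale_def distrib_left)

lemma mult_scale: "p * scale c q = scale c (p * q)"
proof -
  have "p * Poly_Mapping.single [] c = Poly_Mapping.single [] c * p"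
    by (induction p rule: poly_mapping_single_induct)
      (simp_all add: single_mult_single_list distrib_left distrib_right mult.commute)
  then show ?thesis
    by (metis scale_def mult.assoc)
qed

lemma lookup_scale: "Poly_Mapping.lookup (scale c p) w = c * Poly_Mapping.lookup p w"
  by (induction p rule: poly_mapping_single_induct)
    (simp_all add: scale_add_right lookup_add lookup_single distrib_left when_def)

lemma lookup_monomial: "Poly_Mapping.lookup (monomial u) w = (if u = w then 1 else 0)"
  by (simp add: monomial_def lookup_single when_def)

lemma lookup_letter_mult:
  "Poly_Mapping.lookup (monomial [b] * p) u =
    (case u of [] \<Rightarrow> 0 | c # u' \<Rightarrow> if b = c then Poly_Mapping.lookup p u' else 0)"
  by (induction p rule: poly_mapping_single_induct)
    (auto simp: monomial_def single_mult_single_list distrib_left lookup_add lookup_single when_def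
      split: list.split)

lemma gen_X_power: "gen_X ^ n = monomial (replicate n LX)"
  by (induction n) (simp_all add: gen_X_def monomial_def one_free_alg single_mult_single_list)

section \<open>The pairing and elements ending in Y\<close>

lemma pairing_single_left [simp]:
  "pairing (Poly_Mapping.single u c) q = c * Poly_Mapping.lookup q u"
  by (simp add: pairing_def)

lemma pairing_0_left [simp]: "pairing 0 q = 0"
  by (simp add: pairing_def)

lemma pairing_add_left: "pairing (p + p') q = pairing p q + pairing p' q"
  unfolding pairing_def by (rule setsum_keys_plus_distrib) (simp_all add: distrib_right)

lemma pairing_add_right: "pairing p (q + q') = pairing p q + pairing p q'"
  by (simp add: pairing_def lookup_add distrib_left sum.distrib)

lemma pairing_diff_right: "pairing p (q - q') = pairing p q - pairing p q'"
  by (simp add: pairing_def lookup_minus right_diff_distrib sum_subtractf)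

lemma pairing_scale_left: "pairing (scale c p) q = c * pairing p q"
  by (induction p rule: poly_mapping_single_induct)
    (simp_all add: scale_add_right pairing_add_left distrib_left mult.assoc)

lemma pairing_scale_right: "pairing p (scale c q) = c * pairing p q"
  by (simp add: pairing_def lookup_scale sum_distrib_left mult.left_commute)

lemma pairing_single_right [simp]:
  "pairing p (Poly_Mapping.single w c) = Poly_Mapping.lookup p w * c"
  by (induction p rule: poly_mapping_single_induct)
    (simp_all add: pairing_add_left lookup_add lookup_single distrib_right when_def)

lemma pairing_mult_gen_Y_gen_Y: "pairing (p * gen_Y) (q * gen_Y) = pairing p q"
proof (induction p rule: poly_mapping_single_induct)
  case (single u c)
  show ?case
    by (induction q rule: poly_mapping_single_induct)
      (simp_all add: gen_Y_def monomial_def single_mult_single_list distrib_right lookup_add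
        lookup_single distrib_left when_def)
qed (simp add: distrib_right pairing_add_left)

lemma pairing_mult_gen_Y_gen_X: "pairing (p * gen_Y) (q * gen_X) = 0"
proof (induction p rule: poly_mapping_single_induct)
  case (single u c)
  show ?case
    by (induction q rule: poly_mapping_single_induct)
      (simp_all add: gen_Y_def gen_X_def monomial_def single_mult_single_list distrib_right
        lookup_add lookup_single distrib_left)
qed (simp add: distrib_right pairing_add_left)

lemma pairing_mult_gen_Y_one: "pairing (p * gen_Y) 1 = 0"
  by (induction p rule: poly_mapping_single_induct)
    (simp_all add: gen_Y_def monomial_def one_free_alg single_mult_single_list distrib_right
      lookup_add lookup_single)

text \<open>In \<open>q * [X, Y_ad k]\<close> the summand ending in X is orthogonal to everything
  ending in Y. The other summand moves one X into \<open>q\<close>, which is why \<open>q\<close> is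
  generalized.\<close>

lemma pairing_mult_gen_Y_Y_ad:
  "pairing (p * gen_Y) (q * Y_ad k) = pairing p (q * gen_X ^ k)"
proof (induction k arbitrary: q)
  case 0
  then show ?case
    by (simp add: pairing_mult_gen_Y_gen_Y)
next
  case (Suc k)
  have "q * Y_ad (Suc k) = (q * gen_X) * Y_ad k - (q * Y_ad k) * gen_X"
    by (simp add: commutator_def right_diff_distrib mult.assoc)
  then have "pairing (p * gen_Y) (q * Y_ad (Suc k)) = pairing p (q * gen_X * gen_X ^ k)"
    by (simp only: pairing_diff_right pairing_mult_gen_Y_gen_X Suc.IH diff_zero)
  then show ?case
    by (simp only: power_Suc mult.assoc)
qed

section \<open>Shuffling with powers of X and its adjoint\<close>

lemma lookup_shuffle_words_Nil:
  "Poly_Mapping.lookup (shuffle_words u v) [] = (if u = [] \<and> v = [] then 1 else 0)"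
  by (induction u v rule: shuffle_words.induct)
    (auto simp: lookup_add lookup_letter_mult lookup_monomial)

lemma lookup_shuffle_words_Cons:
  "Poly_Mapping.lookup (shuffle_words u v :: 'r::comm_ring_1 free_alg) (a # w) =
    (case u of [] \<Rightarrow> 0 | b # u' \<Rightarrow> if a = b then Poly_Mapping.lookup (shuffle_words u' v) w else 0) +
    (case v of [] \<Rightarrow> 0 | b # v' \<Rightarrow> if a = b then Poly_Mapping.lookup (shuffle_words u v') w else 0)"
proof (cases u; cases v)
  fix b u'
  assume "u = b # u'" "v = []"
  then show ?thesis
    \<comment> \<open>Different equations evaluate \<open>shuffle_words u' []\<close> for empty and
      nonempty \<open>u'\<close>.\<close>
    by (cases u') (auto simp: lookup_monomial)
qed (auto simp: lookup_add lookup_letter_mult lookup_monomial)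

text \<open>The coefficient of \<open>z^n\<close> in the image of the word under X \<mapsto> X + z,
  Y \<mapsto> Y, with z central.\<close>

fun unshuffle_word :: "nat \<Rightarrow> letter list \<Rightarrow> 'r::comm_ring_1 free_alg" where
  "unshuffle_word n [] = (if n = 0 then 1 else 0)"
| "unshuffle_word n (LX # w) =
     gen_X * unshuffle_word n w + (if n = 0 then 0 else unshuffle_word (n - 1) w)"
| "unshuffle_word n (LY # w) = gen_Y * unshuffle_word n w"

text \<open>Both sides obey the same recursion on \<open>w\<close>: a leading X comes from
  \<open>u\<close> or from the block of X's, a leading Y only from \<open>u\<close>.\<close>

lemma lookup_shuffle_words_replicate:
  "Poly_Mapping.lookup (shuffle_words u (replicate n LX)) w =
    Poly_Mapping.lookup (unshuffle_word n w) u"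
proof (induction n w arbitrary: u rule: unshuffle_word.induct)
  case (1 n)
  then show ?case
    by (auto simp: lookup_shuffle_words_Nil one_free_alg lookup_single)
next
  case (2 n w)
  then show ?case
    by (cases n)
      (auto simp: lookup_shuffle_words_Cons lookup_add gen_X_def lookup_letter_mult
        split: list.split)
next
  case (3 n w)
  then show ?case
    by (cases n)
      (auto simp: lookup_shuffle_words_Cons lookup_add gen_Y_def lookup_letter_mult
        split: list.split)
qed

text \<open>The operator \<open>D n\<close> from above: the adjoint of shuffling with \<open>X^n\<close>.\<close>

definition unshuffle :: "nat \<Rightarrow> 'r::comm_ring_1 free_alg \<Rightarrow> 'r free_alg" where
  "unshuffle n p =
    (\<Sum>w\<in>Poly_Mapping.keys p. scale (Poly_Mapping.lookup p w) (unshuffle_word n w))"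

lemma unshuffle_single [simp]:
  "unshuffle n (Poly_Mapping.single w c) = scale c (unshuffle_word n w)"
  by (simp add: unshuffle_def)

lemma unshuffle_add: "unshuffle n (p + q) = unshuffle n p + unshuffle n q"
  unfolding unshuffle_def by (rule setsum_keys_plus_distrib) (simp_all add: scale_add_left)

lemma unshuffle_diff: "unshuffle n (p - q) = unshuffle n p - unshuffle n q"
  by (metis add_diff_cancel diff_add_cancel unshuffle_add)

lemma unshuffle_one: "unshuffle n 1 = (if n = 0 then 1 else 0)"
  by (simp add: one_free_alg)

lemma unshuffle_gen_X_mult:
  "unshuffle n (gen_X * p) = gen_X * unshuffle n p + (if n = 0 then 0 else unshuffle (n - 1) p)"
  by (induction p rule: poly_mapping_single_induct)
    (auto simp: gen_X_def monomial_def single_mult_single_list unshuffle_add distrib_left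
      scale_add_right mult_scale)

lemma unshuffle_gen_Y_mult: "unshuffle n (gen_Y * p) = gen_Y * unshuffle n p"
  by (induction p rule: poly_mapping_single_induct)
    (auto simp: gen_Y_def monomial_def single_mult_single_list unshuffle_add distrib_left
      mult_scale)

text \<open>Both summands of the commutator contribute the same term of index \<open>n - 1\<close>,
  and these cancel.\<close>

lemma unshuffle_Y_ad_mult: "unshuffle n (Y_ad k * p) = Y_ad k * unshuffle n p"
proof (induction k arbitrary: n p)
  case 0
  then show ?case
    by (simp add: unshuffle_gen_Y_mult)
next
  case (Suc k)
  have "Y_ad (Suc k) * p = gen_X * (Y_ad k * p) - Y_ad k * (gen_X * p)"
    by (simp add: commutator_def left_diff_distrib mult.assoc)
  then show ?case
    by (simp add: unshuffle_diff unshuffle_gen_X_mult Suc.IH commutator_def algebra_simps)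
qed

text \<open>This is the binomial expansion of \<open>(X + z)^m\<close>, proved by Pascal's
  rule.\<close>

lemma unshuffle_gen_X_power:
  "unshuffle n (gen_X ^ m) = scale (of_nat (m choose n)) (gen_X ^ (m - n))"
proof (induction m arbitrary: n)
  case 0
  then show ?case
    by (cases n) (simp_all add: unshuffle_one scale_def flip: one_free_alg)
next
  case (Suc m)
  show ?case
  proof (cases n)
    case 0
    then show ?thesis
      by (simp add: unshuffle_gen_X_mult Suc.IH mult_scale)
  next
    case (Suc l)
    \<comment> \<open>For \<open>l \<ge> m\<close> the truncated exponents do not match, but the
      binomial coefficient is 0.\<close>
    have "gen_X * scale (of_nat (m choose Suc l)) (gen_X ^ (m - Suc l)) =
      (scale (of_nat (m choose Suc l)) (gen_X ^ (m - l)) :: 'a free_alg)"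
    proof (cases "l < m")
      case True
      then have "m - l = Suc (m - Suc l)"
        by simp
      then show ?thesis
        by (simp add: mult_scale)
    qed (simp add: binomial_eq_0)
    with Suc show ?thesis
      by (simp add: unshuffle_gen_X_mult Suc.IH scale_add_left)
  qed
qed

lemma unshuffle_magnus:
  "unshuffle n (magnus (ks, m)) = scale (of_nat (m choose n)) (magnus (ks, m - n))"
  by (induction ks)
    (simp_all add: unshuffle_gen_X_power unshuffle_Y_ad_mult mult_scale mult.assoc)

lemma shuffle_gen_X_power:
  "shuffle p (gen_X ^ n) = (\<Sum>u\<in>Poly_Mapping.keys p.
     scale (Poly_Mapping.lookup p u) (shuffle_words u (replicate n LX)))"
  by (simp add: shuffle_def gen_X_power monomial_def)

lemma shuffle_add_gen_X_power:
  "shuffle (p + q) (gen_X ^ n) = shuffle p (gen_X ^ n) + shuffle q (gen_X ^ n)"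
  unfolding shuffle_gen_X_power by (rule setsum_keys_plus_distrib) (simp_all add: scale_add_left)

lemma pairing_shuffle_gen_X_power:
  "pairing (shuffle p (gen_X ^ n)) q = pairing p (unshuffle n q)"
proof (induction p rule: poly_mapping_single_induct)
  case (single u c)
  have "pairing (shuffle_words u (replicate n LX)) q = Poly_Mapping.lookup (unshuffle n q) u"
    by (induction q rule: poly_mapping_single_induct)
      (simp_all add: lookup_shuffle_words_replicate lookup_scale pairing_add_right unshuffle_add
        lookup_add mult.commute)
  then show ?case
    by (simp add: shuffle_gen_X_power pairing_scale_left)
qed (simp add: shuffle_add_gen_X_power pairing_add_left)

section \<open>Recursion for the pairing\<close>

lemma shuffle_one_gen_X_power: "shuffle 1 (gen_X ^ n) = gen_X ^ n"
  unfolding shuffle_gen_X_power one_free_alg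
  by (simp add: gen_X_power scale_def monomial_def single_mult_single_list)

text \<open>Starting the fold at 1 treats the empty list uniformly and exposes the last Y for
  induction from the right.\<close>

definition demi_shuffle_prefix :: "nat list \<Rightarrow> 'r::comm_ring_1 free_alg" where
  "demi_shuffle_prefix = foldl (\<lambda>p j. shuffle p (gen_X ^ j) * gen_Y) 1"

lemma demi_shuffle_prefix_Nil: "demi_shuffle_prefix [] = 1"
  by (simp add: demi_shuffle_prefix_def)

lemma demi_shuffle_eq:
  "demi_shuffle (ts, n) = shuffle (demi_shuffle_prefix ts) (gen_X ^ n)"
  by (cases ts) (simp_all add: demi_shuffle_prefix_def shuffle_one_gen_X_power)

lemma demi_shuffle_prefix_snoc: "demi_shuffle_prefix (ts @ [n]) = demi_shuffle (ts, n) * gen_Y"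
  by (simp add: demi_shuffle_eq) (simp add: demi_shuffle_prefix_def)

lemma pairing_demi_shuffle_magnus:
  "pairing (demi_shuffle (ts, n)) (magnus (ks, m)) =
    of_nat (m choose n) * pairing (demi_shuffle_prefix ts) (magnus (ks, m - n))"
  by (simp only: demi_shuffle_eq pairing_shuffle_gen_X_power unshuffle_magnus pairing_scale_right)

lemma magnus_Suc: "magnus (ks, Suc m) = magnus (ks, m) * gen_X"
  by (simp add: power_Suc2 mult.assoc del: power_Suc)

lemma magnus_snoc_0: "magnus (ks @ [k], 0) = prod_list (map Y_ad ks) * Y_ad k"
  by simp

lemma pairing_one_gen_X_mult: "pairing 1 (gen_X * q) = 0"
  by (simp add: one_free_alg gen_X_def lookup_letter_mult)

lemma pairing_one_Y_ad_mult: "pairing 1 (Y_ad k * q) = 0"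
proof (induction k arbitrary: q)
  case 0
  then show ?case
    by (simp add: one_free_alg gen_Y_def lookup_letter_mult)
next
  case (Suc k)
  have "Y_ad (Suc k) * q = gen_X * (Y_ad k * q) - Y_ad k * (gen_X * q)"
    by (simp add: commutator_def left_diff_distrib mult.assoc)
  then show ?case
    by (simp add: pairing_diff_right pairing_one_gen_X_mult Suc.IH)
qed

lemma pairing_one_magnus: "pairing 1 (magnus (ks, m)) = (if ks = [] \<and> m = 0 then 1 else 0)"
proof (cases ks)
  case Nil
  then show ?thesis
    by (cases m) (simp_all add: pairing_one_gen_X_mult, simp add: one_free_alg)
qed (simp add: mult.assoc pairing_one_Y_ad_mult)

text \<open>Induction from the right, with \<open>m\<close> generalized because the last entry of
  \<open>ks\<close> becomes the special entry of a shorter index.\<close>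

lemma pairing_demi_shuffle_prefix_magnus:
  "pairing (demi_shuffle_prefix ts) (magnus (ks, m)) = (if ts = ks \<and> m = 0 then 1 else 0)"
proof (induction ts arbitrary: ks m rule: rev_induct)
  case Nil
  show ?case
    unfolding demi_shuffle_prefix_Nil pairing_one_magnus by auto
next
  case (snoc n ts)
  show ?case
  proof (cases m)
    case (Suc l)
    then show ?thesis
      by (simp only: demi_shuffle_prefix_snoc magnus_Suc pairing_mult_gen_Y_gen_X) simp
  next
    case 0
    show ?thesis
    proof (cases ks rule: rev_cases)
      case Nil
      with 0 show ?thesis
        by (simp add: demi_shuffle_prefix_snoc pairing_mult_gen_Y_one)
    next
      case (snoc ks' k)
      have "pairing (demi_shuffle_prefix (ts @ [n])) (magnus (ks' @ [k], 0)) =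
        (pairing (demi_shuffle (ts, n)) (magnus (ks', k)) :: 'a)"
        unfolding demi_shuffle_prefix_snoc magnus_snoc_0 pairing_mult_gen_Y_Y_ad by simp
      also have "\<dots> = of_nat (k choose n) * (if ts = ks' \<and> k - n = 0 then 1 else 0)"
        by (simp only: pairing_demi_shuffle_magnus snoc.IH)
      \<comment> \<open>Truncated subtraction gives only \<open>k \<le> n\<close>; for
        \<open>k < n\<close> the binomial coefficient vanishes, and for \<open>k = n\<close> it is
        1.\<close>
      also have "\<dots> = (if ts = ks' \<and> n = k then 1 else 0)"
        by (cases n k rule: linorder_cases) (auto simp: binomial_eq_0)
      finally show ?thesis
        using 0 snoc by simp
    qed
  qed
qed

theorem theorem2p4:
  fixes t k :: index
  shows "pairing (demi_shuffle t) (magnus k :: 'r::{idom, ring_char_0} free_alg)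
    = (if t = k then 1 else 0)"
proof -
  obtain ts n ks m where "t = (ts, n)" "k = (ks, m)"
    by (metis surj_pair)
  \<comment> \<open>Again the binomial coefficient turns \<open>m \<le> n\<close> into
    equality.\<close>
  moreover have "of_nat (m choose n) * (if ts = ks \<and> m - n = 0 then 1 else 0) =
    (if ts = ks \<and> n = m then 1 else 0 :: 'r)"
    by (cases n m rule: linorder_cases) (auto simp: binomial_eq_0)
  ultimately show ?thesis
    by (simp only: pairing_demi_shuffle_magnus pairing_demi_shuffle_prefix_magnus prod.inject)
qed

end
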